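(* Let $A_1,\dots,A_M\in\mathbb{R}^{n\times n}$, $\mathcal{M}=\{1,\dots,M\}$ and $A(w)=\sum_{i\in\mathcal{M}}w_iA_i$ for $w\in\mathcal{W}$. (DT) If there exist $P\succ0$ and $\eta\in(0,1)$ such that, for all $i\in\mathcal{M}$, $$\eta(A_i^\top PA_i-P)+(1-\eta)(A_i^\top-I)P(A_i-I)\preccurlyeq0,$$ then the difference inclusion $x(k+1)=A(w(k))x(k)$ is weakly convergent. (CT) If there exist $P\succ0$ and $\epsilon>0$ such that, for all $i\in\mathcal{M}$, $$A_i^\top P+PA_i+\epsilon A_i^\top PA_i\preccurlyeq0,$$ then the differential inclusion $\dot x(t)=A(w(t))x(t)$ is weakly convergent.
   Context: $\mathcal{W}=\{w\in\mathbb{R}^M:\ \sum_{i\in\mathcal{M}}w_i=1,\ w_i\ge0\ \forall i\in\mathcal{M}\}$. The inclusion is weakly convergent if for every sequence $w(k)\in\mathcal{W}$, $k\in\mathbb{N}$ (resp. every measurable function $w(t)\in\mathcal{W}$, $t\ge0$) and every $x(0)\in\mathbb{R}^n$ there exists $\bar x\in\mathbb{R}^n$ such that the solution converges to $\bar x$ as time tends to infinity. $P\succ0$ means that $P$ is symmetric positive definite; $M\preccurlyeq0$ means that the symmetric matrix $M$ is negative semi-definite. *)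

theory Defs
  imports "HOL-Analysis.Analysis"
begin

definition pos_def :: "real^'n^'n \<Rightarrow> bool" where
  "pos_def P \<longleftrightarrow> transpose P = P \<and> (\<forall>v. v \<noteq> 0 \<longrightarrow> v \<bullet> (P *v v) > 0)"

definition neg_semidef :: "real^'n^'n \<Rightarrow> bool" where
  "neg_semidef Q \<longleftrightarrow> transpose Q = Q \<and> (\<forall>v. v \<bullet> (Q *v v) \<le> 0)"

(* The index set {1,...,M} is rendered by the finite type 'm. *)
definition weights :: "(real^'m) set" where
  "weights = {w. (\<Sum>i\<in>UNIV. w $ i) = 1 \<and> (\<forall>i. 0 \<le> w $ i)}"

definition comb :: "('m::finite \<Rightarrow> real^'n^'n) \<Rightarrow> real^'m \<Rightarrow> real^'n^'n" where
  "comb A w = (\<Sum>i\<in>UNIV. w $ i *\<^sub>R A i)"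

definition dt_solution ::
  "('m::finite \<Rightarrow> real^'n^'n) \<Rightarrow> (nat \<Rightarrow> real^'m) \<Rightarrow> (nat \<Rightarrow> real^'n) \<Rightarrow> bool" where
  "dt_solution A w x \<longleftrightarrow> (\<forall>k. x (k + 1) = comb A (w k) *v x k)"

definition dt_weakly_convergent :: "('m::finite \<Rightarrow> real^'n^'n) \<Rightarrow> bool" where
  "dt_weakly_convergent A \<longleftrightarrow>
     (\<forall>w x0. (\<forall>k. w k \<in> weights) \<longrightarrow>
        (\<forall>x. dt_solution A w x \<and> x 0 = x0 \<longrightarrow> (\<exists>xbar. x \<longlonglongrightarrow> xbar)))"

(* The usual epsilon-delta definition: D ranges over the finite families of
   non-overlapping compact intervals [Inf K, Sup K] contained in [a, b]. *)
definition abs_cont_on :: "real \<Rightarrow> real \<Rightarrow> (real \<Rightarrow> 'a::real_normed_vector) \<Rightarrow> bool" where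
  "abs_cont_on a b f \<longleftrightarrow>
     (\<forall>\<epsilon>>0. \<exists>\<delta>>0. \<forall>D. D division_of (\<Union>D) \<and> \<Union>D \<subseteq> {a..b} \<and> (\<Sum>K\<in>D. Sup K - Inf K) < \<delta> \<longrightarrow>
        (\<Sum>K\<in>D. norm (f (Sup K) - f (Inf K))) < \<epsilon>)"

(* Since t \<mapsto> A(w(t)) is only measurable, a solution on [0, \<infinity>) is understood in the
   sense of Caratheodory: locally absolutely continuous, and satisfying the equation
   for almost every t \<ge> 0. *)
definition ct_solution ::
  "('m::finite \<Rightarrow> real^'n^'n) \<Rightarrow> (real \<Rightarrow> real^'m) \<Rightarrow> (real \<Rightarrow> real^'n) \<Rightarrow> bool" where
  "ct_solution A w x \<longleftrightarrow>
     (\<forall>T\<ge>0. abs_cont_on 0 T x) \<and>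
     (AE t in lebesgue_on {0..}.
        (x has_vector_derivative comb A (w t) *v x t) (at t within {0..}))"

definition ct_weakly_convergent :: "('m::finite \<Rightarrow> real^'n^'n) \<Rightarrow> bool" where
  "ct_weakly_convergent A \<longleftrightarrow>
     (\<forall>w x0. w \<in> borel_measurable (lebesgue_on {0..}) \<and> (\<forall>t\<ge>0. w t \<in> weights) \<longrightarrow>
        (\<forall>x. ct_solution A w x \<and> x 0 = x0 \<longrightarrow> (\<exists>xbar. (x \<longlongrightarrow> xbar) at_top)))"

end

theory Submission
  imports Defs
begin

text \<open>
  Write $q(x) = x^\top P x$. Both matrix inequalities say that certain maps $T_i$ satisfy
  $q(T_i x) + c\,|T_i x - x|^2 \le q(x)$ with some $c > 0$: in discrete time $T_i = A_i$, in
  continuous time $T_i = I + hA_i$ with $h = \epsilon/2$. This makes the squared steps of every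
  trajectory summable, which alone does not give convergence. What has to be shown is that the
  steps themselves are summable.

  The central fact (\<open>path_len_bounded\<close>) is that all finite words in the letters
  $T_1, \dots, T_M$ trace paths from $x$ whose length is at most $C|x|$, with one constant $C$ for
  all words. It is proved by induction on the set $S$ of letters that may occur. Cut a word into
  blocks, each ending as soon as every letter of $S$ has been used. The part of a block
  before its last letter uses fewer letters, so its length is controlled by the induction
  hypothesis. A block that dissipates little energy moves little, so each letter of $S$ almost
  fixes its starting point, which is then close to the common fixed space of $S$. Common fixed
  vectors can be subtracted without changing any step; after this subtraction a block contracts
  $\sqrt q$ by a factor below 1, and the block lengths form a geometric series.

  Consequently $V(x)$, the supremum of the lengths of all paths from $x$, is finite, and
  $V(T_i x) + |T_i x - x| \le V(x)$ because a path from $T_i x$ can be prefixed with the step from $x$.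
  As $V$ is sublinear, the same inequality holds for convex combinations of the $T_i$; this is how
  the finitely many letters control all weights. So $V$ decreases along every
  solution by at least the distance travelled. In discrete time this is a telescoping sum. In
  continuous time the function $t \mapsto V(x(t)) + |x(t) - x(a)|$ is absolutely continuous and
  infinitesimally nonincreasing almost everywhere, hence nonincreasing. Either way $x$ satisfies
  the Cauchy criterion.
\<close>

section \<open>Path lengths of words\<close>

text \<open>Words act on points from left to right, as \<open>fold\<close> does.\<close>

primrec path_len :: "('i \<Rightarrow> 'a::real_normed_vector \<Rightarrow> 'a) \<Rightarrow> 'i list \<Rightarrow> 'a \<Rightarrow> real" where
  "path_len T [] x = 0"
| "path_len T (i # w) x = norm (T i x - x) + path_len T w (T i x)"

lemma path_len_append: "path_len T (u @ w) x = path_len T u x + path_len T w (fold T u x)"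
  by (induction u arbitrary: x) auto

lemma norm_fold_diff_le_path_len: "norm (fold T w x - x) \<le> path_len T w x"
proof (induction w arbitrary: x)
  case (Cons i w)
  have "norm (fold T w (T i x) - x) \<le> norm (fold T w (T i x) - T i x) + norm (T i x - x)"
    using norm_triangle_ineq[of "fold T w (T i x) - T i x" "T i x - x"] by simp
  then show ?case using Cons[of "T i x"] by simp
qed simp

text \<open>The letter at which the alphabet of a word becomes complete. It ends the block in the induction on
  alphabets, and the prefix in front of it lives in a strictly smaller alphabet.\<close>
lemma split_at_last_new_letter:
  assumes "w \<noteq> []"
  shows "\<exists>u i r. w = u @ i # r \<and> i \<notin> set u \<and> set w = insert i (set u)"
  using assms
proof (induction w rule: rev_induct)
  case (snoc j w)
  show ?case
  proof (cases "j \<in> set w")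
    case True
    then have "w \<noteq> []" by auto
    with snoc.IH obtain u i r where "w = u @ i # r" "i \<notin> set u" "set w = insert i (set u)"
      by blast
    then have "w @ [j] = u @ i # (r @ [j])" "i \<notin> set u" "set (w @ [j]) = insert i (set u)"
      using True by auto
    then show ?thesis by blast
  next
    case False
    then have "w @ [j] = w @ j # []" "j \<notin> set w" "set (w @ [j]) = insert j (set w)" by auto
    then show ?thesis by blast
  qed
qed simp

text \<open>Linear regularity: on the orthogonal complement of its kernel a linear map is injective, hence
  bounded below.\<close>
lemma linear_dist_kernel_bound:
  fixes f :: "'a::euclidean_space \<Rightarrow> 'b::euclidean_space"
  assumes "linear f"
  shows "\<exists>\<kappa>\<ge>0. \<forall>x. \<exists>z. f z = 0 \<and> norm (x - z) \<le> \<kappa> * norm (f x)"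
proof -
  let ?K = "{z. f z = 0}"
  have K: "subspace ?K" by (simp add: subspace_def linear_0[OF assms] linear_add[OF assms] linear_cmul[OF assms])
  define L where "L = {y. \<forall>z\<in>?K. orthogonal y z}"
  have L: "subspace L"
    unfolding L_def by (simp add: subspace_def orthogonal_clauses)
  have "\<exists>e>0. \<forall>y\<in>L. norm (f y) \<ge> e * norm y"
  proof (rule injective_imp_isometric[OF closed_subspace[OF L] L])
    show "bounded_linear f" using assms linear_conv_bounded_linear by blast
    show "\<forall>x\<in>L. f x = 0 \<longrightarrow> x = 0"
    proof (intro ballI impI)
      fix x assume "x \<in> L" "f x = 0"
      then have "orthogonal x x" by (simp add: L_def)
      then show "x = 0" by (simp add: orthogonal_self)
    qed
  qed
  then obtain e where e: "e > 0" "\<And>y. y \<in> L \<Longrightarrow> e * norm y \<le> norm (f y)" by blast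
  have "\<exists>z. f z = 0 \<and> norm (x - z) \<le> (1 / e) * norm (f x)" for x
  proof -
    obtain z y where zy: "z \<in> span ?K" "\<And>w. w \<in> span ?K \<Longrightarrow> orthogonal y w" "x = z + y"
      using orthogonal_subspace_decomp_exists[of ?K x] by blast
    have "f z = 0" using span_minimal[OF order_refl K] zy(1) by blast
    moreover have "y \<in> L" using zy(2)[OF span_base] by (simp add: L_def)
    moreover have "f x = f y" using zy(3) \<open>f z = 0\<close> by (simp add: linear_add[OF assms])
    ultimately have "norm (x - z) \<le> (1 / e) * norm (f x)"
      using e(2)[of y] e(1) zy(3) by (simp add: field_simps)
    with \<open>f z = 0\<close> show ?thesis by blast
  qed
  then show ?thesis using e(1) by (intro exI[of _ "1/e"]) auto
qed

section \<open>Families of energy-dissipating linear maps\<close>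

text \<open>The two-sided comparison of the energy \<open>q\<close> with the squared norm turns small residuals into small
  energies and small energies into short steps.\<close>

locale damped_family =
  fixes T :: "'i::finite \<Rightarrow> 'a::euclidean_space \<Rightarrow> 'a"
    and q :: "'a \<Rightarrow> real" and c m M :: real
  assumes lin: "\<And>i. linear (T i)"
    and c_pos: "c > 0" and m_pos: "m > 0"
    and q_lower: "\<And>x. m * (norm x)\<^sup>2 \<le> q x"
    and q_upper: "\<And>x. q x \<le> M * (norm x)\<^sup>2"
    and q_step: "\<And>i x. q (T i x) + c * (norm (T i x - x))\<^sup>2 \<le> q x"
begin

lemma q_nonneg: "0 \<le> q x"
  by (rule order_trans[OF _ q_lower]) (use m_pos in simp)

lemma q_T_le: "q (T i x) \<le> q x"
proof -
  have "0 \<le> c * (norm (T i x - x))\<^sup>2" using c_pos by simp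
  then show ?thesis using q_step[of i x] by linarith
qed

lemma q_fold_le: "q (fold T w x) \<le> q x"
proof (induction w arbitrary: x)
  case (Cons i w)
  from Cons[of "T i x"] q_T_le[of i x] show ?case by simp
qed simp

lemma norm_step_le: "norm (T i x - x) \<le> (1 / sqrt c) * sqrt (q x - q (T i x))"
proof -
  have "(norm (T i x - x))\<^sup>2 \<le> (q x - q (T i x)) / c"
    using q_step[of i x] c_pos by (simp add: field_simps)
  then have "norm (T i x - x) \<le> sqrt ((q x - q (T i x)) / c)"
    by (rule real_le_rsqrt)
  then show ?thesis by (simp add: real_sqrt_divide)
qed

lemma norm_step_le': "norm (T i x - x) \<le> (1 / sqrt c) * sqrt (q x)"
proof -
  have "sqrt (q x - q (T i x)) \<le> sqrt (q x)" using q_nonneg[of "T i x"] by simp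
  then have "(1 / sqrt c) * sqrt (q x - q (T i x)) \<le> (1 / sqrt c) * sqrt (q x)"
    using c_pos by (intro mult_left_mono) auto
  then show ?thesis using norm_step_le[of i x] by linarith
qed

lemma sqrt_q_le_norm: "sqrt (q x) \<le> sqrt \<bar>M\<bar> * norm x"
proof -
  have "M * (norm x)\<^sup>2 \<le> \<bar>M\<bar> * (norm x)\<^sup>2" by (intro mult_right_mono) auto
  then have "q x \<le> \<bar>M\<bar> * (norm x)\<^sup>2" using q_upper[of x] by linarith
  then have "sqrt (q x) \<le> sqrt (\<bar>M\<bar> * (norm x)\<^sup>2)" by simp
  then show ?thesis by (simp add: real_sqrt_mult)
qed

definition residual :: "'i set \<Rightarrow> 'a \<Rightarrow> real" where
  "residual S x = (\<Sum>i\<in>S. norm (T i x - x))"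

lemma residual_nonneg: "0 \<le> residual S x"
  by (simp add: residual_def sum_nonneg)

text \<open>Steps are insensitive to translation by common fixed vectors. This replaces passing to the
  quotient by the fixed space.\<close>
lemma residual_diff_fixed:
  assumes "\<forall>i\<in>S. T i z = z"
  shows "residual S (x - z) = residual S x"
  unfolding residual_def using assms by (intro sum.cong) (auto simp: linear_diff[OF lin])

lemma path_len_diff_fixed:
  assumes "\<forall>i\<in>set w. T i z = z"
  shows "path_len T w (x - z) = path_len T w x"
  using assms by (induction w arbitrary: x) (auto simp: linear_diff[OF lin])

text \<open>A point can be moved by a common fixed vector of \<open>S\<close> so that its energy does not grow and is
  dominated by the residual. The first of the two bounds lets the induction compare the moved point with
  the original one.\<close>
definition shift_bound :: "real \<Rightarrow> 'i set \<Rightarrow> bool" where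
  "shift_bound \<kappa> S \<longleftrightarrow> (\<forall>x. \<exists>z. (\<forall>i\<in>S. T i z = z) \<and> sqrt (q (x - z)) \<le> sqrt (q x)
      \<and> sqrt (q (x - z)) \<le> \<kappa> * residual S x)"

lemma shift_boundE:
  assumes "shift_bound \<kappa> S"
  obtains z where "\<forall>i\<in>S. T i z = z" "sqrt (q (x - z)) \<le> sqrt (q x)"
    "sqrt (q (x - z)) \<le> \<kappa> * residual S x"
  using assms unfolding shift_bound_def by blast

text \<open>The displacements of all letters of \<open>S\<close> are stacked into one linear map, whose kernel is the
  common fixed space. If the fixed vector provided by linear regularity would increase the energy, then the
  energy of \<open>x\<close> is already dominated by the residual and no shift is made.\<close>
lemma ex_shift_bound: "\<exists>\<kappa>\<ge>0. shift_bound \<kappa> S"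
proof -
  define f :: "'a \<Rightarrow> 'a ^ 'i" where "f x = (\<chi> i. if i \<in> S then T i x - x else 0)" for x
  have "linear f"
    by (rule linearI)
      (auto simp: f_def vec_eq_iff linear_add[OF lin] linear_cmul[OF lin] scaleR_diff_right)
  then obtain \<kappa> where \<kappa>: "\<kappa> \<ge> 0" "\<And>x. \<exists>z. f z = 0 \<and> norm (x - z) \<le> \<kappa> * norm (f x)"
    using linear_dist_kernel_bound by blast
  have f_le: "norm (f x) \<le> residual S x" for x
  proof -
    have "norm (f x) \<le> (\<Sum>i\<in>UNIV. norm (f x $ i))" 
      unfolding norm_vec_def by (rule L2_set_le_sum) simp
    also have "\<dots> = residual S x"
      unfolding residual_def f_def by (simp add: if_distrib sum.If_cases cong: if_cong)
    finally show ?thesis .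
  qed
  have "\<exists>z. (\<forall>i\<in>S. T i z = z) \<and> sqrt (q (x - z)) \<le> sqrt (q x)
      \<and> sqrt (q (x - z)) \<le> (sqrt \<bar>M\<bar> * \<kappa>) * residual S x" for x
  proof -
    obtain z where z: "f z = 0" "norm (x - z) \<le> \<kappa> * norm (f x)" using \<kappa>(2) by blast
    have "T i z = z" if "i \<in> S" for i
      using arg_cong[OF z(1), of "\<lambda>v. v $ i"] that by (simp add: f_def)
    then have fix_z: "\<forall>i\<in>S. T i z = z" by blast
    have "sqrt (q (x - z)) \<le> sqrt \<bar>M\<bar> * norm (x - z)" by (rule sqrt_q_le_norm)
    also have "\<dots> \<le> sqrt \<bar>M\<bar> * (\<kappa> * residual S x)"
      using z(2) mult_left_mono[OF f_le \<kappa>(1)] by (intro mult_left_mono) (auto intro: order_trans)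
    finally have small: "sqrt (q (x - z)) \<le> (sqrt \<bar>M\<bar> * \<kappa>) * residual S x" by (simp add: mult.assoc)
    show ?thesis
    proof (cases "sqrt (q (x - z)) \<le> sqrt (q x)")
      case True
      then show ?thesis using fix_z small by blast
    next
      case False
      then have "sqrt (q x) \<le> (sqrt \<bar>M\<bar> * \<kappa>) * residual S x" using small by linarith
      then show ?thesis by (intro exI[of _ 0]) (auto simp: linear_0[OF lin])
    qed
  qed
  then have "shift_bound (sqrt \<bar>M\<bar> * \<kappa>) S" unfolding shift_bound_def by blast
  then show ?thesis using \<kappa>(1) by (intro exI[of _ "sqrt \<bar>M\<bar> * \<kappa>"]) auto
qed

lemma shift_bound_mono:
  assumes "shift_bound \<kappa> S" "\<kappa> \<le> \<kappa>'"
  shows "shift_bound \<kappa>' S"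
  unfolding shift_bound_def
proof
  fix x
  obtain z where "\<forall>i\<in>S. T i z = z" "sqrt (q (x - z)) \<le> sqrt (q x)"
      "sqrt (q (x - z)) \<le> \<kappa> * residual S x"
    using assms(1) by (rule shift_boundE)
  then show "\<exists>z. (\<forall>i\<in>S. T i z = z) \<and> sqrt (q (x - z)) \<le> sqrt (q x)
      \<and> sqrt (q (x - z)) \<le> \<kappa>' * residual S x"
    using mult_right_mono[OF assms(2) residual_nonneg, of S x] by (intro exI[of _ z]) auto
qed

lemma ex_shift_bound_uniform: "\<exists>\<kappa>\<ge>0. \<forall>S. shift_bound \<kappa> S"
proof -
  have "\<forall>S. \<exists>\<kappa>. \<kappa> \<ge> 0 \<and> shift_bound \<kappa> S" using ex_shift_bound by simp
  from choice[OF this] obtain k where k: "\<And>S. k S \<ge> 0" "\<And>S. shift_bound (k S) S"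
    by auto
  have "k S \<le> (\<Sum>S\<in>UNIV. k S)" for S
    using k(1) by (intro member_le_sum) auto
  then have "\<forall>S. shift_bound (\<Sum>S\<in>UNIV. k S) S"
    by (intro allI shift_bound_mono[OF k(2)])
  then show ?thesis by (intro exI[of _ "\<Sum>S\<in>UNIV. k S"] conjI sum_nonneg k(1))
qed

text \<open>The two statements of the induction on alphabets. The second one concerns only words that use
  every letter of \<open>S\<close>, and says that they cannot dissipate little energy unless the starting point is
  almost fixed by all of \<open>S\<close>.\<close>
definition bounded_alphabet :: "real \<Rightarrow> 'i set \<Rightarrow> bool" where
  "bounded_alphabet C S \<longleftrightarrow>
     (\<forall>w x. set w \<subseteq> S \<longrightarrow> path_len T w x \<le> C * sqrt (q x)) \<and>
     (\<forall>w x. set w = S \<longrightarrow> residual S x \<le> C * sqrt (q x - q (fold T w x)))"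

lemma bounded_alphabet_mono:
  assumes "bounded_alphabet C S" "C \<le> C'"
  shows "bounded_alphabet C' S"
proof -
  have 1: "C * sqrt (q x) \<le> C' * sqrt (q x)" for x
    using assms(2) q_nonneg by (intro mult_right_mono) auto
  have 2: "C * sqrt (q x - q (fold T w x)) \<le> C' * sqrt (q x - q (fold T w x))" for w x
    using assms(2) q_fold_le[of w x] by (intro mult_right_mono) auto
  show ?thesis
    unfolding bounded_alphabet_def
  proof (intro conjI allI impI)
    show "path_len T w x \<le> C' * sqrt (q x)" if "set w \<subseteq> S" for w x
      by (rule order_trans[OF _ 1]) (use assms(1) that in \<open>simp add: bounded_alphabet_def\<close>)
    show "residual S x \<le> C' * sqrt (q x - q (fold T w x))" if "set w = S" for w x
      by (rule order_trans[OF _ 2]) (use assms(1) that in \<open>simp add: bounded_alphabet_def\<close>)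
  qed
qed

text \<open>Up to the last new letter \<open>i\<close>, the word uses the smaller alphabet \<open>set u\<close>. By hypothesis a small
  energy drop makes the residual of that alphabet small, so after a shift the path along \<open>u\<close> is
  short. The point where \<open>i\<close> acts is then close to \<open>x\<close>, and \<open>i\<close> moves it little, so \<open>i\<close> moves \<open>x\<close> little
  as well.\<close>
lemma residual_le_sqrt_drop:
  assumes IH: "\<And>S'. S' \<subset> S \<Longrightarrow> bounded_alphabet C S'" and C: "C \<ge> 0"
  shows "\<exists>K\<ge>0. \<forall>w x. set w = S \<longrightarrow> residual S x \<le> K * sqrt (q x - q (fold T w x))"
proof -
  obtain \<kappa> where \<kappa>: "\<kappa> \<ge> 0"
    "\<And>S. shift_bound \<kappa> S"
    using ex_shift_bound_uniform by blast
  define b where "b = 1 / sqrt c"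
  have b: "b \<ge> 0" using c_pos by (simp add: b_def)
  define K where "K = C + b + b * (sqrt \<bar>M\<bar> * (C * (\<kappa> * C)))"
  have K: "K \<ge> 0" using C b \<kappa>(1) by (simp add: K_def)
  have "residual S x \<le> K * sqrt (q x - q (fold T w x))" if w: "set w = S" for w x
  proof (cases "w = []")
    case True
    then show ?thesis using w by (auto simp: residual_def)
  next
    case False
    then obtain u i r where uir: "w = u @ i # r" "i \<notin> set u" "set w = insert i (set u)"
      using split_at_last_new_letter by blast
    define \<Delta> where "\<Delta> = sqrt (q x - q (fold T w x))"
    define y where "y = fold T u x"
    have S: "S = insert i (set u)" "set u \<subset> S" using w uir by auto
    have q_le: "q (fold T w x) \<le> q (T i y)" "q (T i y) \<le> q y" "q y \<le> q x"
      using uir(1) q_fold_le q_T_le by (auto simp: y_def)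
    have \<Delta>0: "\<Delta> \<ge> 0" using q_le by (simp add: \<Delta>_def)
    have drop_u: "sqrt (q x - q y) \<le> \<Delta>" and drop_i: "sqrt (q y - q (T i y)) \<le> \<Delta>"
      using q_le by (simp_all add: \<Delta>_def)
    have res_u: "residual (set u) x \<le> C * \<Delta>"
    proof -
      have "residual (set u) x \<le> C * sqrt (q x - q y)"
        using IH[OF S(2)] unfolding bounded_alphabet_def y_def by blast
      also have "\<dots> \<le> C * \<Delta>" using drop_u C by (rule mult_left_mono)
      finally show ?thesis .
    qed
    have disp: "norm (x - y) \<le> C * (\<kappa> * (C * \<Delta>))"
    proof -
      obtain z where z: "\<forall>i\<in>set u. T i z = z" "sqrt (q (x - z)) \<le> \<kappa> * residual (set u) x"
        using \<kappa>(2) by (rule shift_boundE)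
      have "norm (x - y) \<le> path_len T u x"
        using norm_fold_diff_le_path_len[of T u x] by (simp add: y_def norm_minus_commute)
      also have "\<dots> = path_len T u (x - z)" using path_len_diff_fixed[OF z(1)] by simp
      also have "\<dots> \<le> C * sqrt (q (x - z))"
        using IH[OF S(2)] unfolding bounded_alphabet_def by blast
      also have "\<dots> \<le> C * (\<kappa> * (C * \<Delta>))"
        using z(2) mult_left_mono[OF res_u \<kappa>(1)] C by (intro mult_left_mono) auto
      finally show ?thesis .
    qed
    have "T i x - x = (T i y - y) + (T i (x - y) - (x - y))"
      by (simp add: linear_diff[OF lin])
    then have "norm (T i x - x) \<le> norm (T i y - y) + norm (T i (x - y) - (x - y))"
      by (metis norm_triangle_ineq)
    also have "\<dots> \<le> b * sqrt (q y - q (T i y)) + b * sqrt (q (x - y))"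
      using norm_step_le norm_step_le' unfolding b_def by (intro add_mono) auto
    also have "\<dots> \<le> b * \<Delta> + b * (sqrt \<bar>M\<bar> * (C * (\<kappa> * (C * \<Delta>))))"
      using drop_i b sqrt_q_le_norm[of "x - y"] mult_left_mono[OF disp, of "sqrt \<bar>M\<bar>"]
      by (intro add_mono mult_left_mono) auto
    finally have "norm (T i x - x) \<le> b * \<Delta> + b * (sqrt \<bar>M\<bar> * (C * (\<kappa> * (C * \<Delta>))))" .
    moreover have "residual S x = norm (T i x - x) + residual (set u) x"
      using S(1) uir(2) by (simp add: residual_def)
    ultimately show ?thesis using res_u
      unfolding \<Delta>_def[symmetric] K_def by (simp add: algebra_simps)
  qed
  with K show ?thesis by blast
qed

text \<open>After the shift, a block dissipates a fixed fraction of the energy, which contracts \<open>sqrt (q _)\<close> by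
  the factor \<open>\<theta>\<close>. The length of the block itself is at most \<open>C + b\<close> times the initial \<open>sqrt (q _)\<close>,
  so the whole path is dominated by a geometric series with sum \<open>D\<close>.\<close>
lemma bounded_alphabet_step:
  assumes IH: "\<And>S'. S' \<subset> S \<Longrightarrow> bounded_alphabet C S'" and C: "C \<ge> 0"
  shows "\<exists>C'\<ge>0. bounded_alphabet C' S"
proof -
  obtain K where K: "K \<ge> 0"
    "\<And>w x. set w = S \<Longrightarrow> residual S x \<le> K * sqrt (q x - q (fold T w x))"
    using residual_le_sqrt_drop[OF IH C] by blast
  obtain \<kappa> where \<kappa>: "\<kappa> \<ge> 0"
    "\<And>S. shift_bound \<kappa> S"
    using ex_shift_bound_uniform by blast
  define b where "b = 1 / sqrt c"
  have b: "b \<ge> 0" using c_pos by (simp add: b_def)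
  define L where "L = (\<kappa> * K)\<^sup>2"
  define \<theta> where "\<theta> = sqrt (L / (L + 1))"
  define D where "D = (C + b) / (1 - \<theta>)"
  have L: "L \<ge> 0" by (simp add: L_def)
  have \<theta>: "0 \<le> \<theta>" "\<theta> < 1" using L by (auto simp: \<theta>_def)
  have D: "C + b \<le> D" "C + b + D * \<theta> = D" "D \<ge> 0"
  proof -
    show "C + b + D * \<theta> = D" using \<theta> by (simp add: D_def field_simps)
    show "D \<ge> 0" using \<theta> C b by (simp add: D_def)
    then show "C + b \<le> D" using \<open>C + b + D * \<theta> = D\<close> mult_nonneg_nonneg[OF \<open>D \<ge> 0\<close> \<theta>(1)] by linarith
  qed
  have len: "path_len T w x \<le> D * sqrt (q x)" if "set w \<subseteq> S" for w x
    using that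
  proof (induction w arbitrary: x rule: length_induct)
    case (1 w)
    consider "w = []" | "set w \<subset> S" | "w \<noteq> []" "set w = S" using 1(2) by blast
    then show ?case
    proof cases
      case 1
      then show ?thesis using D(3) q_nonneg by simp
    next
      case 2
      then have "path_len T w x \<le> C * sqrt (q x)" using IH unfolding bounded_alphabet_def by blast
      also have "\<dots> \<le> D * sqrt (q x)" using D(1) b q_nonneg by (intro mult_right_mono) auto
      finally show ?thesis .
    next
      case 3
      then obtain u i r where uir: "w = u @ i # r" "i \<notin> set u" "set w = insert i (set u)"
        using split_at_last_new_letter by blast
      have S: "S = set (u @ [i])" "set u \<subset> S" using 3 uir by auto
      obtain z where z: "\<forall>i\<in>S. T i z = z" "sqrt (q (x - z)) \<le> sqrt (q x)"
        "sqrt (q (x - z)) \<le> \<kappa> * residual S x"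
        using \<kappa>(2) by (rule shift_boundE)
      define y where "y = x - z"
      define y1 where "y1 = fold T u y"
      define y2 where "y2 = T i y1"
      have y2: "fold T (u @ [i]) y = y2" by (simp add: y2_def y1_def)
      have y2_le: "q y2 \<le> q y" using q_fold_le[of "u @ [i]" y] y2 by simp
      \<comment> \<open>A full block contracts the energy of the shifted point.\<close>
      have "sqrt (q y) \<le> \<kappa> * residual S y"
        using z(3) residual_diff_fixed[OF z(1)] by (simp add: y_def)
      also have "\<dots> \<le> \<kappa> * (K * sqrt (q y - q y2))"
        using K(2)[OF S(1)[symmetric], of y] \<kappa>(1) unfolding y2 by (rule mult_left_mono)
      finally have "(sqrt (q y))\<^sup>2 \<le> (\<kappa> * K * sqrt (q y - q y2))\<^sup>2"
        using q_nonneg[of y] by (intro power_mono) (auto simp: mult.assoc)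
      then have "q y \<le> L * (q y - q y2)"
        using q_nonneg[of y] y2_le by (simp add: power_mult_distrib L_def)
      then have "(L + 1) * q y2 \<le> L * q y"
        using y2_le by (simp add: algebra_simps)
      then have "q y2 \<le> L / (L + 1) * q y" using L by (simp add: field_simps)
      then have "sqrt (q y2) \<le> sqrt (L / (L + 1) * q y)" by simp
      then have contr: "sqrt (q y2) \<le> \<theta> * sqrt (q y)" unfolding \<theta>_def real_sqrt_mult .
      have "path_len T w x = path_len T w y"
        using path_len_diff_fixed[of w z x] z(1) 3(2) by (simp add: y_def)
      also have "\<dots> = path_len T u y + norm (y2 - y1) + path_len T r y2"
        by (simp add: uir(1) path_len_append y1_def y2_def)
      also have "\<dots> \<le> C * sqrt (q y) + b * sqrt (q y) + D * (\<theta> * sqrt (q y))"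
      proof (intro add_mono)
        show "path_len T u y \<le> C * sqrt (q y)" using IH[OF S(2)] unfolding bounded_alphabet_def by blast
        have "norm (y2 - y1) \<le> b * sqrt (q y1)" unfolding y2_def b_def by (rule norm_step_le')
        also have "\<dots> \<le> b * sqrt (q y)" using b q_fold_le[of u y] by (intro mult_left_mono) (auto simp: y1_def)
        finally show "norm (y2 - y1) \<le> b * sqrt (q y)" .
        have "path_len T r y2 \<le> D * sqrt (q y2)" using 1 uir(1) by auto
        also have "\<dots> \<le> D * (\<theta> * sqrt (q y))" using contr D(3) by (rule mult_left_mono)
        finally show "path_len T r y2 \<le> D * (\<theta> * sqrt (q y))" .
      qed
      also have "\<dots> = (C + b + D * \<theta>) * sqrt (q y)" by (simp add: algebra_simps)
      also have "\<dots> \<le> D * sqrt (q x)" using D z(2) by (simp add: y_def mult_left_mono)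
      finally show ?thesis .
    qed
  qed
  have "bounded_alphabet (D + K) S"
    unfolding bounded_alphabet_def
  proof (intro conjI allI impI)
    show "path_len T w x \<le> (D + K) * sqrt (q x)" if "set w \<subseteq> S" for w x
      using len[OF that, of x] K(1) q_nonneg[of x] by (simp add: distrib_right add_increasing2)
    show "residual S x \<le> (D + K) * sqrt (q x - q (fold T w x))" if "set w = S" for w x
      using K(2)[OF that, of x] D(3) q_fold_le[of w x] by (simp add: distrib_right add_increasing)
  qed
  then show ?thesis using D(3) K(1) by (intro exI[of _ "D + K"]) auto
qed

lemma ex_bounded_alphabet: "\<exists>C\<ge>0. bounded_alphabet C S"
  using finite[of S]
proof (induction S rule: finite_psubset_induct)
  case (psubset S)
  then obtain k where k: "\<And>S'. S' \<subset> S \<Longrightarrow> k S' \<ge> 0 \<and> bounded_alphabet (k S') S'" by metis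
  define C where "C = (\<Sum>S'\<in>{S'. S' \<subset> S}. k S')"
  have "bounded_alphabet C S'" if "S' \<subset> S" for S'
  proof (rule bounded_alphabet_mono)
    show "bounded_alphabet (k S') S'" using k that by blast
    show "k S' \<le> C" unfolding C_def using k that by (intro member_le_sum) auto
  qed
  moreover have "C \<ge> 0" unfolding C_def using k by (intro sum_nonneg) auto
  ultimately show ?case by (rule bounded_alphabet_step)
qed

theorem path_len_bounded: "\<exists>C. \<forall>w x. path_len T w x \<le> C * norm x"
proof -
  obtain C where C: "C \<ge> 0" "bounded_alphabet C UNIV" using ex_bounded_alphabet by blast
  have "path_len T w x \<le> (C * sqrt \<bar>M\<bar>) * norm x" for w x
    using C(2) mult_left_mono[OF sqrt_q_le_norm C(1), of x]
    order_trans[of "path_len T w x" "C * sqrt (q x)"]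
    unfolding bounded_alphabet_def by (simp add: mult.assoc)
  then show ?thesis by blast
qed

lemma path_len_add: "path_len T w (x + y) \<le> path_len T w x + path_len T w y"
proof (induction w arbitrary: x y)
  case (Cons i w)
  have "norm (T i (x + y) - (x + y)) \<le> norm (T i x - x) + norm (T i y - y)"
    using norm_triangle_ineq[of "T i x - x" "T i y - y"]
    by (simp add: linear_add[OF lin] algebra_simps)
  then show ?case using Cons[of "T i x" "T i y"] by (simp add: linear_add[OF lin])
qed simp

lemma path_len_scale: "path_len T w (a *\<^sub>R x) = \<bar>a\<bar> * path_len T w x"
proof (induction w arbitrary: x)
  case (Cons i w)
  have "norm (T i (a *\<^sub>R x) - a *\<^sub>R x) = \<bar>a\<bar> * norm (T i x - x)"
    by (simp add: linear_cmul[OF lin] flip: scaleR_diff_right)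
  then show ?case using Cons[of "T i x"] by (simp add: linear_cmul[OF lin] distrib_left)
qed simp

text \<open>The witness is the supremum of the path lengths over all words. It inherits sublinearity from the
  path lengths, and it decreases along a step by the length of that step because a word can be extended at
  its front.\<close>
theorem ex_length_decreasing_function:
  obtains V :: "'a \<Rightarrow> real" and C where
    "\<And>x. 0 \<le> V x" "\<And>x. V x \<le> C * norm x"
    "\<And>x y. V (x + y) \<le> V x + V y" "\<And>a x. 0 \<le> a \<Longrightarrow> V (a *\<^sub>R x) \<le> a * V x"
    "\<And>i x. V (T i x) + norm (T i x - x) \<le> V x"
proof -
  obtain C where C: "\<And>w x. path_len T w x \<le> C * norm x" using path_len_bounded by blast
  define V where "V x = (SUP w. path_len T w x)" for x
  have bdd: "bdd_above (range (\<lambda>w. path_len T w x))" for x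
    by (rule bdd_aboveI2) (rule C)
  have up: "path_len T w x \<le> V x" for w x
    unfolding V_def by (rule cSUP_upper[OF _ bdd]) simp
  have least: "V x \<le> B" if "\<And>w. path_len T w x \<le> B" for x B
    unfolding V_def by (rule cSUP_least) (auto intro: that)
  show ?thesis
  proof (rule that[of V C])
    show "0 \<le> V x" for x using up[of "[]" x] by simp
    show "V x \<le> C * norm x" for x by (rule least) (rule C)
    show "V (x + y) \<le> V x + V y" for x y
      by (rule least, rule order_trans[OF path_len_add], intro add_mono up)
    show "V (a *\<^sub>R x) \<le> a * V x" if "0 \<le> a" for a x
      using that by (intro least) (simp add: path_len_scale mult_left_mono up)
    show "V (T i x) + norm (T i x - x) \<le> V x" for i x
    proof -
      have "V (T i x) \<le> V x - norm (T i x - x)"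
        by (rule least) (use up[of "i # _" x] in \<open>simp add: algebra_simps\<close>)
      then show ?thesis by simp
    qed
  qed
qed

text \<open>Jensen's inequality for the sublinear \<open>V\<close>, together with the triangle inequality for the
  displacement, carries the decrease from the individual maps to their convex combinations.\<close>
theorem ex_length_decreasing_function_convex_hull:
  obtains V :: "'a \<Rightarrow> real" and C where
    "\<And>x. 0 \<le> V x" "\<And>x. V x \<le> C * norm x"
    "\<And>x y. V (x + y) \<le> V x + V y" "\<And>a x. 0 \<le> a \<Longrightarrow> V (a *\<^sub>R x) \<le> a * V x"
    "\<And>l x. l \<in> weights \<Longrightarrow>
       V (\<Sum>i\<in>UNIV. l $ i *\<^sub>R T i x) + norm ((\<Sum>i\<in>UNIV. l $ i *\<^sub>R T i x) - x) \<le> V x"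
proof -
  obtain V :: "'a \<Rightarrow> real" and C where V:
    "\<And>x. 0 \<le> V x" "\<And>x. V x \<le> C * norm x"
    "\<And>x y. V (x + y) \<le> V x + V y" "\<And>a x. 0 \<le> a \<Longrightarrow> V (a *\<^sub>R x) \<le> a * V x"
    "\<And>i x. V (T i x) + norm (T i x - x) \<le> V x"
    using ex_length_decreasing_function by blast
  have V0: "V 0 \<le> 0" using V(2)[of 0] by simp
  have Vsum: "V (\<Sum>i\<in>F. f i) \<le> (\<Sum>i\<in>F. V (f i))" if "finite F" for F :: "'i set" and f
    using that by (induction F) (auto intro: order_trans[OF V(3)] simp: V0)
  have "V (\<Sum>i\<in>UNIV. l $ i *\<^sub>R T i x) + norm ((\<Sum>i\<in>UNIV. l $ i *\<^sub>R T i x) - x) \<le> V x"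
    if "l \<in> weights" for l x
  proof -
    have l: "(\<Sum>i\<in>UNIV. l $ i) = 1" "\<And>i. 0 \<le> l $ i" using that by (auto simp: weights_def)
    have "(\<Sum>i\<in>UNIV. l $ i *\<^sub>R T i x) - x = (\<Sum>i\<in>UNIV. l $ i *\<^sub>R (T i x - x))"
      by (simp add: scaleR_diff_right sum_subtractf l(1) flip: scaleR_left.sum)
    then have "norm ((\<Sum>i\<in>UNIV. l $ i *\<^sub>R T i x) - x) \<le> (\<Sum>i\<in>UNIV. l $ i * norm (T i x - x))"
      using l(2) by (auto intro!: sum_norm_le)
    moreover have "V (\<Sum>i\<in>UNIV. l $ i *\<^sub>R T i x) \<le> (\<Sum>i\<in>UNIV. l $ i * V (T i x))"
      using l(2) V(4) by (intro order_trans[OF Vsum] sum_mono) auto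
    moreover have "(\<Sum>i\<in>UNIV. l $ i * V (T i x)) + (\<Sum>i\<in>UNIV. l $ i * norm (T i x - x))
        \<le> (\<Sum>i\<in>UNIV. l $ i * V x)"
      unfolding sum.distrib[symmetric] distrib_left[symmetric]
      using l(2) V(5) by (intro sum_mono mult_left_mono) auto
    moreover have "(\<Sum>i\<in>UNIV. l $ i * V x) = V x" by (simp add: l(1) flip: sum_distrib_right)
    ultimately show ?thesis by linarith
  qed
  then show ?thesis using that[OF V(1-4)] by blast
qed

end

section \<open>Absolutely continuous functions that decrease almost everywhere\<close>

lemma abs_cont_on_subinterval:
  assumes f: "abs_cont_on a b f" and sub: "a \<le> a'" "b' \<le> b"
  shows "abs_cont_on a' b' f"
  unfolding abs_cont_on_def
proof (intro allI impI)
  fix \<epsilon> :: real assume "\<epsilon> > 0"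
  then obtain \<delta> where \<delta>: "\<delta> > 0" "\<And>D. D division_of (\<Union>D) \<and> \<Union>D \<subseteq> {a..b} \<and> (\<Sum>K\<in>D. Sup K - Inf K) < \<delta>
      \<Longrightarrow> (\<Sum>K\<in>D. norm (f (Sup K) - f (Inf K))) < \<epsilon>"
    using f unfolding abs_cont_on_def by blast
  have "{a'..b'} \<subseteq> {a..b}" using sub by auto
  then have "(\<Sum>K\<in>D. norm (f (Sup K) - f (Inf K))) < \<epsilon>"
    if "D division_of (\<Union>D) \<and> \<Union>D \<subseteq> {a'..b'} \<and> (\<Sum>K\<in>D. Sup K - Inf K) < \<delta>" for D
    using that \<delta>(2)[of D] order_trans[of "\<Union>D" "{a'..b'}" "{a..b}"] by blast
  with \<delta>(1) show "\<exists>\<delta>>0. \<forall>D. D division_of (\<Union>D) \<and> \<Union>D \<subseteq> {a'..b'} \<and> (\<Sum>K\<in>D. Sup K - Inf K) < \<delta>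
      \<longrightarrow> (\<Sum>K\<in>D. norm (f (Sup K) - f (Inf K))) < \<epsilon>"
    by blast
qed

lemma abs_cont_on_lipschitz_compose:
  fixes \<Phi> :: "'a::real_normed_vector \<Rightarrow> 'b::real_normed_vector"
  assumes f: "abs_cont_on a b f" and L: "L > 0"
    and lip: "\<And>x y. norm (\<Phi> x - \<Phi> y) \<le> L * norm (x - y)"
  shows "abs_cont_on a b (\<lambda>t. \<Phi> (f t))"
  unfolding abs_cont_on_def
proof (intro allI impI)
  fix \<epsilon> :: real assume "\<epsilon> > 0"
  then have "\<epsilon> / L > 0" using L by simp
  then obtain \<delta> where \<delta>: "\<delta> > 0" "\<And>D. D division_of (\<Union>D) \<and> \<Union>D \<subseteq> {a..b} \<and> (\<Sum>K\<in>D. Sup K - Inf K) < \<delta>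
      \<Longrightarrow> (\<Sum>K\<in>D. norm (f (Sup K) - f (Inf K))) < \<epsilon> / L"
    using f unfolding abs_cont_on_def by blast
  have "(\<Sum>K\<in>D. norm (\<Phi> (f (Sup K)) - \<Phi> (f (Inf K)))) < \<epsilon>"
    if D: "D division_of (\<Union>D) \<and> \<Union>D \<subseteq> {a..b} \<and> (\<Sum>K\<in>D. Sup K - Inf K) < \<delta>" for D
  proof -
    have "(\<Sum>K\<in>D. norm (\<Phi> (f (Sup K)) - \<Phi> (f (Inf K)))) \<le> L * (\<Sum>K\<in>D. norm (f (Sup K) - f (Inf K)))"
      unfolding sum_distrib_left by (intro sum_mono lip)
    also have "\<dots> < \<epsilon>" using \<delta>(2)[OF D] L by (simp add: field_simps)
    finally show ?thesis .
  qed
  then show "\<exists>\<delta>>0. \<forall>D. D division_of (\<Union>D) \<and> \<Union>D \<subseteq> {a..b} \<and> (\<Sum>K\<in>D. Sup K - Inf K) < \<delta>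
      \<longrightarrow> (\<Sum>K\<in>D. norm (\<Phi> (f (Sup K)) - \<Phi> (f (Inf K)))) < \<epsilon>"
    using \<delta>(1) by blast
qed


text \<open>By Cousin's lemma there is a tagged division fine for a gauge that confines cells with a tag in the
  null set \<open>N\<close> to an open set of small measure, and all other cells to neighbourhoods where the increment
  is at most \<open>\<eta>\<close> times the length. The former cells contribute little by absolute continuity, the latter
  by the choice of \<open>\<eta>\<close>. The hypothesis compares \<open>\<phi>\<close> on both sides of \<open>t\<close>, since a tag may lie anywhere in its cell.\<close>
lemma abs_cont_on_ae_nonincreasing_le:
  fixes \<phi> :: "real \<Rightarrow> real"
  assumes ac: "abs_cont_on a b \<phi>" and ab: "a \<le> b" and N: "negligible N"
    and loc: "\<And>t \<eta>. t \<in> {a..b} - N \<Longrightarrow> \<eta> > 0 \<Longrightarrow>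
      \<exists>d>0. \<forall>u\<in>{a..t}. \<forall>v\<in>{t..b}. t - d < u \<and> v < t + d \<longrightarrow> \<phi> v - \<phi> u \<le> \<eta> * (v - u)"
  shows "\<phi> b \<le> \<phi> a"
proof (rule field_le_epsilon)
  fix e :: real assume e: "e > 0"
  define \<eta> where "\<eta> = e / (2 * (b - a + 1))"
  have \<eta>: "\<eta> > 0" using e ab by (simp add: \<eta>_def)
  have \<eta>_le: "\<eta> * (b - a) \<le> e / 2"
  proof -
    have "\<eta> * (b - a) \<le> \<eta> * (b - a + 1)" using \<eta> by (intro mult_left_mono) auto
    also have "\<dots> = e / 2" using ab by (simp add: \<eta>_def field_simps)
    finally show ?thesis .
  qed
  obtain \<delta> where \<delta>: "\<delta> > 0" "\<And>D. D division_of (\<Union>D) \<and> \<Union>D \<subseteq> {a..b} \<and> (\<Sum>K\<in>D. Sup K - Inf K) < \<delta>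
      \<Longrightarrow> (\<Sum>K\<in>D. norm (\<phi> (Sup K) - \<phi> (Inf K))) < e / 2"
    using ac half_gt_zero[OF e] unfolding abs_cont_on_def by blast
  have N_sets: "N \<in> sets lebesgue" and N0: "emeasure lebesgue N = 0"
    using N by (auto simp: negligible_iff_null_sets)
  obtain G where G: "open G" "N \<subseteq> G" "G - N \<in> lmeasurable" "emeasure lebesgue (G - N) < ennreal \<delta>"
    using sets_lebesgue_outer_open[OF N_sets \<delta>(1)] by blast
  have G_small: "emeasure lebesgue G < ennreal \<delta>"
  proof -
    have "emeasure lebesgue G = emeasure lebesgue (N \<union> (G - N))" using G(2) by (simp add: Un_absorb1)
    also have "\<dots> \<le> emeasure lebesgue N + emeasure lebesgue (G - N)"
      using N_sets G(3) by (intro emeasure_subadditive) auto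
    finally show ?thesis using G(4) N0 by simp
  qed
  have "\<exists>d>0. t \<in> {a..b} - N \<longrightarrow>
      (\<forall>u\<in>{a..t}. \<forall>v\<in>{t..b}. t - d < u \<and> v < t + d \<longrightarrow> \<phi> v - \<phi> u \<le> \<eta> * (v - u))" for t
  proof (cases "t \<in> {a..b} - N")
    case True
    from loc[OF this \<eta>] show ?thesis by auto
  qed (use zero_less_one in blast)
  then have "\<forall>t. \<exists>d. d > 0 \<and> (t \<in> {a..b} - N \<longrightarrow>
      (\<forall>u\<in>{a..t}. \<forall>v\<in>{t..b}. t - d < u \<and> v < t + d \<longrightarrow> \<phi> v - \<phi> u \<le> \<eta> * (v - u)))"
    by simp
  from choice[OF this] obtain d where d: "\<And>t. d t > 0"
    "\<And>t. t \<in> {a..b} - N \<Longrightarrow>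
      \<forall>u\<in>{a..t}. \<forall>v\<in>{t..b}. t - d t < u \<and> v < t + d t \<longrightarrow> \<phi> v - \<phi> u \<le> \<eta> * (v - u)"
    by auto
  define g where "g t = (if t \<in> N then G else ball t (d t))" for t
  have "gauge g" using G d(1) by (auto simp: gauge_def g_def)
  then obtain p where p: "p tagged_division_of {a..b}" "g fine p"
    using fine_division_exists_real by blast
  have cell: "\<exists>u v. K = {u..v} \<and> a \<le> u \<and> u \<le> t \<and> t \<le> v \<and> v \<le> b \<and> Inf K = u \<and> Sup K = v \<and> K \<subseteq> g t"
    if tK: "(t, K) \<in> p" for t K
  proof -
    obtain u v where uv: "K = {u..v}" using tagged_division_ofD(4)[OF p(1) tK] by auto
    have "t \<in> K" "K \<subseteq> {a..b}" "K \<subseteq> g t"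
      using tagged_division_ofD(2,3)[OF p(1) tK] fineD[OF p(2) tK] by auto
    then show ?thesis using uv by (intro exI[of _ u] exI[of _ v]) auto
  qed
  define p1 where "p1 = {(t, K) \<in> p. t \<in> N}"
  define D where "D = snd ` p1"
  have fin: "finite p" using p(1) by auto
  have p1: "p1 \<subseteq> p" by (auto simp: p1_def)
  have "p tagged_partial_division_of {a..b}" using p(1) by (simp add: tagged_division_of_def)
  then have part: "p1 tagged_partial_division_of {a..b}" using p1 by (rule tagged_partial_division_subset)
  have D_div: "D division_of \<Union>D" unfolding D_def by (rule partial_division_of_tagged_division[OF part])
  have cell_bad: "K \<subseteq> {a..b} \<inter> G" if "(t, K) \<in> p1" for t K
  proof -
    have "(t, K) \<in> p" "t \<in> N" using that by (auto simp: p1_def)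
    then obtain u v where "K = {u..v}" "a \<le> u" "v \<le> b" "K \<subseteq> g t" using cell by blast
    with \<open>t \<in> N\<close> show ?thesis by (auto simp: g_def)
  qed
  have "\<Union>D \<subseteq> {a..b} \<inter> G"
    unfolding D_def
  proof (rule Union_least)
    fix K assume "K \<in> snd ` p1"
    then obtain t where "(t, K) \<in> p1" by auto
    then show "K \<subseteq> {a..b} \<inter> G" by (rule cell_bad)
  qed
  then have D_sub: "\<Union>D \<subseteq> {a..b}" "\<Union>D \<subseteq> G" by blast+
  have D_len: "(\<Sum>K\<in>D. Sup K - Inf K) < \<delta>"
  proof -
    have "(\<Sum>K\<in>D. Sup K - Inf K) = (\<Sum>K\<in>D. measure lebesgue K)"
    proof (rule sum.cong[OF refl])
      fix K assume "K \<in> D"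
      then obtain t where "(t, K) \<in> p" by (auto simp: D_def p1_def)
      then obtain u v where "K = {u..v}" "u \<le> t" "t \<le> v" using cell by blast
      then show "Sup K - Inf K = measure lebesgue K" by simp
    qed
    also have "\<dots> = measure lebesgue (\<Union>D)" by (rule content_division[OF D_div])
    also have "\<dots> < \<delta>"
    proof -
      have "emeasure lebesgue (\<Union>D) \<le> emeasure lebesgue G"
        using D_sub(2) G(1) by (intro emeasure_mono) auto
      then have "emeasure lebesgue (\<Union>D) < ennreal \<delta>" using G_small by (rule le_less_trans)
      then show ?thesis
        using lmeasurable_division[OF D_div] \<delta>(1)
        by (simp add: emeasure_eq_measure2 ennreal_less_iff)
    qed
    finally show ?thesis .
  qed
  have bad: "(\<Sum>(t, K)\<in>p1. \<phi> (Sup K) - \<phi> (Inf K)) \<le> e / 2"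
  proof -
    \<comment> \<open>Two tags can share a degenerate cell, so the sums over tagged and untagged cells agree only because
      degenerate cells contribute zero. The value at the empty set has to be fixed by hand, as the supremum
      and infimum of the empty set are unspecified.\<close>
    define h where "h K = (if K = {} then 0 else norm (\<phi> (Sup K) - \<phi> (Inf K)))" for K :: "real set"
    have ne: "K \<noteq> {}" if "(t, K) \<in> p1" for t K using cell that p1 by fastforce
    have "(\<Sum>(t, K)\<in>p1. \<phi> (Sup K) - \<phi> (Inf K)) \<le> (\<Sum>(t, K)\<in>p1. h K)"
      using ne by (intro sum_mono) (auto simp: h_def)
    also have "\<dots> = (\<Sum>K\<in>D. h K)" unfolding D_def
    proof (rule sum.over_tagged_division_lemma[OF tagged_partial_division_of_Union_self[OF part]])
      fix u v :: real assume "box u v = {}"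
      then show "h (cbox u v) = 0" by (cases "u = v") (auto simp: h_def)
    qed
    also have "\<dots> = (\<Sum>K\<in>D. norm (\<phi> (Sup K) - \<phi> (Inf K)))"
      using ne by (intro sum.cong) (auto simp: h_def D_def)
    also have "\<dots> < e / 2" using \<delta>(2) D_div D_sub(1) D_len by blast
    finally show ?thesis by simp
  qed
  have good: "(\<Sum>(t, K)\<in>p - p1. \<phi> (Sup K) - \<phi> (Inf K)) \<le> e / 2"
  proof -
    have "(\<Sum>(t, K)\<in>p - p1. \<phi> (Sup K) - \<phi> (Inf K)) \<le> (\<Sum>(t, K)\<in>p - p1. \<eta> * (Sup K - Inf K))"
    proof (rule sum_mono, clarify)
      fix t K assume tK: "(t, K) \<in> p" "(t, K) \<notin> p1"
      then have tN: "t \<notin> N" by (auto simp: p1_def)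
      obtain u v where uv: "K = {u..v}" "a \<le> u" "u \<le> t" "t \<le> v" "v \<le> b" "Inf K = u" "Sup K = v" "K \<subseteq> g t"
        using cell[OF tK(1)] by blast
      have "u \<in> K" "v \<in> K" using uv by auto
      then have "u \<in> ball t (d t)" "v \<in> ball t (d t)" using uv(8) tN by (auto simp: g_def)
      then show "\<phi> (Sup K) - \<phi> (Inf K) \<le> \<eta> * (Sup K - Inf K)"
        using d(2)[of t] tN uv by (auto simp: dist_real_def)
    qed
    also have "\<dots> \<le> (\<Sum>(t, K)\<in>p. \<eta> * (Sup K - Inf K))"
      using fin \<eta> cell by (intro sum_mono2) fastforce+
    also have "\<dots> = \<eta> * (b - a)"
      using additive_tagged_division_1[OF ab p(1), of "\<lambda>x. \<eta> * x"] by (simp add: right_diff_distrib)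
    finally show ?thesis using \<eta>_le by simp
  qed
  have "\<phi> b - \<phi> a = (\<Sum>(t, K)\<in>p. \<phi> (Sup K) - \<phi> (Inf K))"
    by (rule additive_tagged_division_1[OF ab p(1), symmetric])
  also have "\<dots> = (\<Sum>(t, K)\<in>p - p1. \<phi> (Sup K) - \<phi> (Inf K)) + (\<Sum>(t, K)\<in>p1. \<phi> (Sup K) - \<phi> (Inf K))"
    by (rule sum.subset_diff[OF p1 fin])
  finally show "\<phi> b \<le> \<phi> a + e" using good bad by simp
qed

text \<open>For a midpoint convex function, being nonincreasing at \<open>x t\<close> in the direction \<open>v\<close> implies that its values in
  the opposite direction are not smaller. This yields the comparison for points on the left of \<open>t\<close>
  from the hypothesis on the right of \<open>t\<close>.\<close>
lemma convex_compose_local_decrease: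
  fixes \<Phi> :: "'a::real_normed_vector \<Rightarrow> real" and x :: "real \<Rightarrow> 'a"
  assumes lip: "\<And>y z. \<Phi> y - \<Phi> z \<le> L * norm (y - z)" and L: "L > 0"
    and midconvex: "\<And>y z. 2 * \<Phi> y \<le> \<Phi> (y - z) + \<Phi> (y + z)"
    and h: "h > 0" and dec: "\<And>s. 0 \<le> s \<Longrightarrow> s \<le> h \<Longrightarrow> \<Phi> (x t + s *\<^sub>R v) \<le> \<Phi> (x t)"
    and der: "(x has_vector_derivative v) (at t within S)" and \<eta>: "\<eta> > 0"
  shows "\<exists>d>0. \<forall>a\<in>S. \<forall>b\<in>S. a \<le> t \<and> t \<le> b \<and> t - d < a \<and> b < t + d
    \<longrightarrow> \<Phi> (x b) - \<Phi> (x a) \<le> \<eta> * (b - a)"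
proof -
  have "\<eta> / L > 0" using \<eta> L by simp
  then obtain d where d: "d > 0"
    "\<And>y. y \<in> S \<Longrightarrow> norm (y - t) < d \<Longrightarrow> norm (x y - x t - (y - t) *\<^sub>R v) \<le> \<eta> / L * norm (y - t)"
    using der unfolding has_vector_derivative_def has_derivative_within_alt by blast
  have near: "L * norm (x y - (x t + (y - t) *\<^sub>R v)) \<le> \<eta> * \<bar>y - t\<bar>"
    if "y \<in> S" "\<bar>y - t\<bar> < d" for y
    using d(2)[OF that(1)] that(2) L by (simp add: field_simps)
  have "\<Phi> (x b) - \<Phi> (x a) \<le> \<eta> * (b - a)"
    if ab: "a \<in> S" "b \<in> S" "a \<le> t" "t \<le> b" "t - min d h < a" "b < t + min d h" for a b
  proof -
    have "\<Phi> (x b) \<le> \<Phi> (x t + (b - t) *\<^sub>R v) + \<eta> * (b - t)"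
    proof -
      have "\<bar>b - t\<bar> < d" using ab by auto
      then show ?thesis
        using lip[of "x b" "x t + (b - t) *\<^sub>R v"] near[of b] ab by auto
    qed
    moreover have "\<Phi> (x t + (b - t) *\<^sub>R v) \<le> \<Phi> (x t)" using ab by (intro dec) auto
    moreover have "\<Phi> (x t - (t - a) *\<^sub>R v) \<le> \<Phi> (x a) + \<eta> * (t - a)"
    proof -
      have eq: "x t + (a - t) *\<^sub>R v = x t - (t - a) *\<^sub>R v" by (simp add: algebra_simps)
      have "\<bar>a - t\<bar> < d" using ab by auto
      then show ?thesis
        using lip[of "x t - (t - a) *\<^sub>R v" "x a"] near[of a] ab
        unfolding norm_minus_commute[of "x t - (t - a) *\<^sub>R v"] eq by auto
    qed
    moreover have "2 * \<Phi> (x t) \<le> \<Phi> (x t - (t - a) *\<^sub>R v) + \<Phi> (x t + (t - a) *\<^sub>R v)"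
      by (rule midconvex)
    moreover have "\<Phi> (x t + (t - a) *\<^sub>R v) \<le> \<Phi> (x t)" using ab by (intro dec) auto
    ultimately show ?thesis by (simp add: algebra_simps)
  qed
  then show ?thesis using d(1) h by (intro exI[of _ "min d h"]) auto
qed

section \<open>Convergence of trajectories\<close>

text \<open>The function \<open>\<Phi> y = V y + norm (y - x a)\<close> is convex and Lipschitz. Where \<open>V\<close> loses at least \<open>s * norm v\<close> over the step
  \<open>s *\<^sub>R v\<close>, the distance to \<open>x a\<close> gains at most as much, so \<open>\<Phi>\<close> does not increase along
  \<open>x\<close>. Comparing its values at \<open>a\<close> and \<open>b\<close> bounds the displacement without integrating the speed.\<close>
lemma displacement_le_decrease:
  fixes V :: "'a::real_normed_vector \<Rightarrow> real" and x :: "real \<Rightarrow> 'a"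
  assumes V_le: "\<And>y. V y \<le> C * norm y"
    and V_add: "\<And>y z. V (y + z) \<le> V y + V z" and V_scale: "\<And>c y. 0 \<le> c \<Longrightarrow> V (c *\<^sub>R y) \<le> c * V y"
    and ac: "\<forall>T\<ge>0. abs_cont_on 0 T x"
    and h: "h > 0"
    and der: "AE t in lebesgue_on {0..}. \<exists>v. (x has_vector_derivative v) (at t within {0..})
        \<and> V (x t + h *\<^sub>R v) + h * norm v \<le> V (x t)"
    and ab: "0 \<le> a" "a \<le> b"
  shows "norm (x b - x a) \<le> V (x a) - V (x b)"
proof -
  define \<Phi> where "\<Phi> y = V y + norm (y - x a)" for y
  define L where "L = \<bar>C\<bar> + 1"
  have L: "L > 0" by (simp add: L_def)
  have lip: "\<Phi> y - \<Phi> z \<le> L * norm (y - z)" for y z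
  proof -
    have "V y \<le> V z + V (y - z)" using V_add[of z "y - z"] by simp
    moreover have "V (y - z) \<le> \<bar>C\<bar> * norm (y - z)"
      by (rule order_trans[OF V_le]) (intro mult_right_mono, auto)
    moreover have "norm (y - x a) \<le> norm (y - z) + norm (z - x a)"
      using norm_triangle_ineq[of "y - z" "z - x a"] by simp
    ultimately show ?thesis by (simp add: \<Phi>_def L_def algebra_simps)
  qed
  have midconvex: "2 * \<Phi> y \<le> \<Phi> (y - z) + \<Phi> (y + z)" for y z
  proof -
    have eq: "y = (1/2) *\<^sub>R ((y - z) + (y + z))" by (simp flip: scaleR_2)
    have "V y \<le> (1/2) * V ((y - z) + (y + z))" using V_scale[of "1/2" "(y - z) + (y + z)"] eq by simp
    then have "2 * V y \<le> V (y - z) + V (y + z)" using V_add[of "y - z" "y + z"] by simp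
    moreover have "2 * norm (y - x a) = norm ((y - z - x a) + (y + z - x a))"
    proof -
      have "(y - z - x a) + (y + z - x a) = 2 *\<^sub>R (y - x a)" by (simp add: scaleR_2 algebra_simps)
      then show ?thesis by simp
    qed
    moreover have "\<dots> \<le> norm (y - z - x a) + norm (y + z - x a)" by (rule norm_triangle_ineq)
    ultimately show ?thesis by (simp add: \<Phi>_def)
  qed
  define bad where "bad t \<longleftrightarrow> \<not> (\<exists>v. (x has_vector_derivative v) (at t within {0..})
      \<and> V (x t + h *\<^sub>R v) + h * norm v \<le> V (x t))" for t
  define N where "N = {t \<in> {0..}. bad t}"
  have "AE t in lebesgue. t \<in> {0..} \<longrightarrow> \<not> bad t"
    using der by (simp add: bad_def AE_restrict_space_iff)
  then have N: "negligible N"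
    unfolding N_def by (simp add: eventually_ae_filter_negligible) (meson negligible_subset)
  have "\<Phi> (x b) \<le> \<Phi> (x a)"
  proof (rule abs_cont_on_ae_nonincreasing_le[OF _ ab(2) N])
    have "abs_cont_on a b x" using ac ab abs_cont_on_subinterval[of 0 b x a b] by simp
    then show "abs_cont_on a b (\<lambda>t. \<Phi> (x t))"
      using L
    proof (rule abs_cont_on_lipschitz_compose)
      fix y z show "norm (\<Phi> y - \<Phi> z) \<le> L * norm (y - z)"
        using lip[of y z] lip[of z y] by (simp add: norm_minus_commute abs_le_iff)
    qed
  next
    fix t \<eta> :: real assume t: "t \<in> {a..b} - N" and \<eta>: "\<eta> > 0"
    then obtain v where v: "(x has_vector_derivative v) (at t within {0..})"
      "V (x t + h *\<^sub>R v) + h * norm v \<le> V (x t)"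
      using ab(1) by (auto simp: N_def bad_def)
    have "\<Phi> (x t + s *\<^sub>R v) \<le> \<Phi> (x t)" if s: "0 \<le> s" "s \<le> h" for s
    proof -
      \<comment> \<open>Convexity interpolates the decrease known for the full step \<open>h\<close>.\<close>
      have eq: "x t + s *\<^sub>R v = (1 - s/h) *\<^sub>R x t + (s/h) *\<^sub>R (x t + h *\<^sub>R v)"
        using h by (simp add: algebra_simps)
      have "V (x t + s *\<^sub>R v) \<le> (1 - s/h) * V (x t) + (s/h) * V (x t + h *\<^sub>R v)"
        unfolding eq using s h by (intro order_trans[OF V_add] add_mono V_scale) auto
      also have "(s/h) * V (x t + h *\<^sub>R v) \<le> (s/h) * (V (x t) - h * norm v)"
        using v(2) s h by (intro mult_left_mono) auto
      also have "(1 - s/h) * V (x t) + (s/h) * (V (x t) - h * norm v) = V (x t) - s * norm v"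
        using h by (simp add: field_simps)
      finally have "V (x t + s *\<^sub>R v) \<le> V (x t) - s * norm v" by simp
      moreover have "norm (x t + s *\<^sub>R v - x a) \<le> norm (x t - x a) + s * norm v"
        using norm_triangle_ineq[of "x t - x a" "s *\<^sub>R v"] s by (simp add: algebra_simps)
      ultimately show ?thesis by (simp add: \<Phi>_def)
    qed
    from convex_compose_local_decrease[OF lip L midconvex h this v(1) \<eta>]
    obtain d where "d > 0" and d: "\<And>u w. u \<in> {0..} \<Longrightarrow> w \<in> {0..} \<Longrightarrow> u \<le> t \<and> t \<le> w \<and> t - d < u \<and> w < t + d
      \<Longrightarrow> \<Phi> (x w) - \<Phi> (x u) \<le> \<eta> * (w - u)" by blast
    then show "\<exists>d>0. \<forall>u\<in>{a..t}. \<forall>w\<in>{t..b}. t - d < u \<and> w < t + d \<longrightarrow> \<Phi> (x w) - \<Phi> (x u) \<le> \<eta> * (w - u)"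
      using ab(1) t by (intro exI[of _ d]) auto
  qed
  then show ?thesis by (simp add: \<Phi>_def)
qed

text \<open>A function bounded below whose decrease dominates the displacement of \<open>x\<close> forces the Cauchy criterion:
  beyond a point where \<open>f\<close> is within \<open>e\<close> of its infimum, nothing moves by \<open>e\<close> or more. The index type covers
  both discrete and continuous time.\<close>
lemma convergent_if_displacement_le_decrease:
  fixes x :: "'b::linorder \<Rightarrow> 'a::banach" and f :: "'b \<Rightarrow> real"
  assumes le: "\<And>s t. t0 \<le> s \<Longrightarrow> s \<le> t \<Longrightarrow> norm (x t - x s) \<le> f s - f t"
    and nonneg: "\<And>t. t0 \<le> t \<Longrightarrow> 0 \<le> f t"
  shows "\<exists>l. (x \<longlongrightarrow> l) at_top"
proof -
  have "cauchy_filter (filtermap x at_top)"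
    unfolding cauchy_filter_metric_filtermap
  proof (intro allI impI)
    fix e :: real assume "e > 0"
    have bdd: "bdd_below (f ` {t0..})" using nonneg by (intro bdd_belowI2[of _ 0]) auto
    have "Inf (f ` {t0..}) < Inf (f ` {t0..}) + e" using \<open>e > 0\<close> by simp
    then obtain s where s: "t0 \<le> s" "f s < Inf (f ` {t0..}) + e"
      using cInf_lessD[of "f ` {t0..}"] by fastforce
    have *: "dist (x u) (x t) < e" if "s \<le> t" "t \<le> u" for t u
    proof -
      have "norm (x u - x t) \<le> f t - f u" using s that by (intro le) auto
      moreover have "norm (x t - x s) \<le> f s - f t" using s that by (intro le) auto
      moreover have "0 \<le> norm (x t - x s)" by simp
      moreover have "Inf (f ` {t0..}) \<le> f u" using bdd s that by (intro cInf_lower) auto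
      ultimately show ?thesis using s(2) unfolding dist_norm by linarith
    qed
    then have "dist (x t) (x u) < e" if "s \<le> t" "s \<le> u" for t u
      using that by (metis dist_commute linear)
    then show "\<exists>P. eventually P at_top \<and> (\<forall>t u. P t \<and> P u \<longrightarrow> dist (x t) (x u) < e)"
      by (intro exI[of _ "\<lambda>t. s \<le> t"]) (auto simp: eventually_ge_at_top)
  qed
  moreover have "complete (UNIV :: 'a set)" by (rule complete_UNIV)
  ultimately show ?thesis
    unfolding complete_uniform filterlim_def
    by (auto simp: filtermap_bot_iff)
qed

section \<open>The matrix inequalities\<close>
lemma comb_mult_vector:
  fixes A :: "'m::finite \<Rightarrow> real^'n^'n"
  shows "comb A w *v x = (\<Sum>i\<in>UNIV. w $ i *\<^sub>R (A i *v x))"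
proof -
  have lin: "linear (\<lambda>B::real^'n^'n. B *v x)"
    by (rule linearI) (simp_all add: matrix_vector_mult_add_rdistrib scaleR_matrix_vector_assoc)
  show ?thesis
    unfolding comb_def by (simp add: linear_sum[OF lin] scaleR_matrix_vector_assoc)
qed

lemma pos_def_lower_bound:
  fixes P :: "real^'n^'n"
  assumes "pos_def P"
  shows "\<exists>m>0. \<forall>x. m * (norm x)\<^sup>2 \<le> x \<bullet> (P *v x)"
proof -
  let ?S = "sphere (0::real^'n) 1"
  have "continuous_on ?S (\<lambda>x. x \<bullet> (P *v x))"
    by (intro continuous_intros linear_continuous_on linear_conv_bounded_linear[THEN iffD1]) auto
  moreover have "?S \<noteq> {}" by simp
  ultimately obtain z where z: "z \<in> ?S" "\<And>y. y \<in> ?S \<Longrightarrow> z \<bullet> (P *v z) \<le> y \<bullet> (P *v y)"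
    using continuous_attains_inf[OF compact_sphere] by blast
  have "z \<bullet> (P *v z) * (norm x)\<^sup>2 \<le> x \<bullet> (P *v x)" for x
  proof (cases "x = 0")
    case False
    have "z \<bullet> (P *v z) \<le> (x /\<^sub>R norm x) \<bullet> (P *v (x /\<^sub>R norm x))"
      using False by (intro z(2)) auto
    also have "\<dots> = (x \<bullet> (P *v x)) / (norm x)\<^sup>2"
      by (simp add: matrix_vector_mult_scaleR power2_eq_square divide_inverse)
    finally show ?thesis using False by (simp add: field_simps)
  qed simp
  moreover have "z \<bullet> (P *v z) > 0" using z(1) assms unfolding pos_def_def by (cases "z = 0") auto
  ultimately show ?thesis by blast
qed

lemma quadratic_form_upper_bound:
  fixes P :: "real^'n^'n"
  shows "\<exists>M. \<forall>x. x \<bullet> (P *v x) \<le> M * (norm x)\<^sup>2"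
proof -
  have "x \<bullet> (P *v x) \<le> onorm ((*v) P) * (norm x)\<^sup>2" for x
  proof -
    have "x \<bullet> (P *v x) \<le> norm x * norm (P *v x)" by (rule norm_cauchy_schwarz)
    also have "\<dots> \<le> norm x * (onorm ((*v) P) * norm x)"
      by (intro mult_left_mono onorm) auto
    finally show ?thesis by (simp add: power2_eq_square algebra_simps)
  qed
  then show ?thesis by blast
qed

lemma inner_transpose_mult: "v \<bullet> (transpose B *v y) = (B *v v) \<bullet> (y :: real^'n)"
  by (metis dot_lmul_matrix inner_commute transpose_matrix_vector)

lemma inner_congruence:
  "v \<bullet> ((transpose B ** P ** C) *v v) = (B *v v) \<bullet> (P *v (C *v (v::real^'n)))"
  by (simp add: inner_transpose_mult matrix_vector_mul_assoc[symmetric] del: transpose_matrix_vector)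

text \<open>Divided by \<open>\<eta>\<close>, the inequality is the dissipation estimate for the maps \<open>A i\<close> themselves, with energy
  \<open>P\<close> and constant \<open>(1 - \<eta>) / \<eta> * m\<close>, where \<open>m\<close> bounds \<open>P\<close> from below.\<close>
lemma dt_weakly_convergent_if:
  fixes A :: "'m::finite \<Rightarrow> real^'n^'n"
  assumes P: "pos_def P" and \<eta>: "0 < \<eta>" "\<eta> < 1"
    and neg: "\<And>i. neg_semidef (\<eta> *\<^sub>R (transpose (A i) ** P ** A i - P)
         + (1 - \<eta>) *\<^sub>R ((transpose (A i) - mat 1) ** P ** (A i - mat 1)))"
  shows "dt_weakly_convergent A"
proof -
  obtain m where m: "m > 0" "\<And>x. m * (norm x)\<^sup>2 \<le> x \<bullet> (P *v x)" using pos_def_lower_bound[OF P] by blast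
  obtain M where M: "\<And>x. x \<bullet> (P *v x) \<le> M * (norm x)\<^sup>2" using quadratic_form_upper_bound by blast
  define c where "c = (1 - \<eta>) / \<eta> * m"
  have step: "(A i *v x) \<bullet> (P *v (A i *v x)) + c * (norm (A i *v x - x))\<^sup>2 \<le> x \<bullet> (P *v x)" for i x
  proof -
    let ?y = "A i *v x - x"
    have tr: "transpose (A i) - mat 1 = transpose (A i - mat 1)"
      by (simp add: transpose_def mat_def vec_eq_iff)
    have "\<eta> * ((A i *v x) \<bullet> (P *v (A i *v x)) - x \<bullet> (P *v x)) + (1 - \<eta>) * (?y \<bullet> (P *v ?y)) \<le> 0"
      using neg[of i] unfolding neg_semidef_def tr
      by (simp add: matrix_vector_mult_add_rdistrib matrix_vector_mult_diff_rdistrib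
          scaleR_matrix_vector_assoc[symmetric] inner_add_right inner_diff_right inner_congruence)
    moreover have "(1 - \<eta>) * (m * (norm ?y)\<^sup>2) \<le> (1 - \<eta>) * (?y \<bullet> (P *v ?y))"
      using m(2) \<eta> by (intro mult_left_mono) auto
    ultimately show ?thesis using \<eta> by (simp add: c_def field_simps)
  qed
  have "c > 0" using m(1) \<eta> by (simp add: c_def)
  interpret damped_family "\<lambda>i x. A i *v x" "\<lambda>x. x \<bullet> (P *v x)" c m M
    by (rule damped_family.intro[OF matrix_vector_mul_linear \<open>c > 0\<close> m M step])
  obtain V :: "real^'n \<Rightarrow> real" and C where V: "\<And>x. 0 \<le> V x" "\<And>x. V x \<le> C * norm x"
    "\<And>x y. V (x + y) \<le> V x + V y" "\<And>a x. 0 \<le> a \<Longrightarrow> V (a *\<^sub>R x) \<le> a * V x"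
    "\<And>l x. l \<in> weights \<Longrightarrow> V (\<Sum>i\<in>UNIV. l $ i *\<^sub>R (A i *v x))
        + norm ((\<Sum>i\<in>UNIV. l $ i *\<^sub>R (A i *v x)) - x) \<le> V x"
    using ex_length_decreasing_function_convex_hull by blast
  show ?thesis
    unfolding dt_weakly_convergent_def
  proof (intro allI impI)
    fix w x0 x assume w: "\<forall>k. w k \<in> weights" and "dt_solution A w x \<and> x 0 = x0"
    then have x: "x (Suc k) = (\<Sum>i\<in>UNIV. w k $ i *\<^sub>R (A i *v x k))" for k
      by (simp add: dt_solution_def comb_mult_vector)
    have "norm (x t - x s) \<le> V (x s) - V (x t)" if "s \<le> t" for s t
      using that
    proof (induction t rule: dec_induct)
      case (step t)
      have "V (x (Suc t)) + norm (x (Suc t) - x t) \<le> V (x t)" unfolding x using w V(5) by blast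
      moreover have "norm (x (Suc t) - x s) \<le> norm (x (Suc t) - x t) + norm (x t - x s)"
        using norm_triangle_ineq[of "x (Suc t) - x t" "x t - x s"] by simp
      ultimately show ?case using step.IH by linarith
    qed simp
    then show "\<exists>xbar. x \<longlonglongrightarrow> xbar"
      using V(1) by (intro convergent_if_displacement_le_decrease[of 0 x "\<lambda>t. V (x t)"]) auto
  qed
qed

text \<open>An Euler step of length \<open>h\<close> satisfies $q(x + hA_ix) - q(x) \le -h(\epsilon - h)\,q(A_ix)$. The
  choice \<open>h = \<epsilon> / 2\<close> makes the right-hand side $-q(T_ix - x)$ with $T_i = I + hA_i$, so the Euler maps form
  a dissipating family. As the weights sum to one, the convex combinations of the Euler maps
  are the Euler maps of \<open>comb A l\<close>.\<close>
lemma ct_weakly_convergent_if: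
  fixes A :: "'m::finite \<Rightarrow> real^'n^'n"
  assumes P: "pos_def P" and \<epsilon>: "0 < \<epsilon>"
    and neg: "\<And>i. neg_semidef (transpose (A i) ** P + P ** A i + \<epsilon> *\<^sub>R (transpose (A i) ** P ** A i))"
  shows "ct_weakly_convergent A"
proof -
  obtain m where m: "m > 0" "\<And>x. m * (norm x)\<^sup>2 \<le> x \<bullet> (P *v x)" using pos_def_lower_bound[OF P] by blast
  obtain M where M: "\<And>x. x \<bullet> (P *v x) \<le> M * (norm x)\<^sup>2" using quadratic_form_upper_bound by blast
  define h where "h = \<epsilon> / 2"
  have h: "h > 0" using \<epsilon> by (simp add: h_def)
  define T where "T i x = x + h *\<^sub>R (A i *v x)" for i x
  have lin: "linear (T i)" for i
    unfolding T_def by (intro linear_compose_add linear_compose_scale_right linear_id[unfolded id_def]) auto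
  have step: "T i x \<bullet> (P *v T i x) + m * (norm (T i x - x))\<^sup>2 \<le> x \<bullet> (P *v x)" for i x
  proof -
    let ?y = "A i *v x"
    have "?y \<bullet> (P *v x) + x \<bullet> (P *v ?y) + 2 * h * (?y \<bullet> (P *v ?y)) \<le> 0"
      using neg[of i] unfolding neg_semidef_def h_def
      by (simp add: matrix_vector_mult_add_rdistrib scaleR_matrix_vector_assoc[symmetric]
          inner_add_right inner_congruence inner_transpose_mult matrix_vector_mul_assoc[symmetric]
          del: transpose_matrix_vector)
    then have "h * (?y \<bullet> (P *v x) + x \<bullet> (P *v ?y) + 2 * h * (?y \<bullet> (P *v ?y))) \<le> 0"
      using h by (simp add: mult_le_0_iff)
    moreover have "T i x \<bullet> (P *v T i x)
        = x \<bullet> (P *v x) + h * (?y \<bullet> (P *v x) + x \<bullet> (P *v ?y)) + h * h * (?y \<bullet> (P *v ?y))"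
      by (simp add: T_def matrix_vector_right_distrib matrix_vector_mult_scaleR inner_add_left
          inner_add_right algebra_simps)
    moreover have "m * (norm (T i x - x))\<^sup>2 \<le> h * h * (?y \<bullet> (P *v ?y))"
    proof -
      have "m * (norm (T i x - x))\<^sup>2 = h * h * (m * (norm ?y)\<^sup>2)"
        using h by (simp add: T_def power_mult_distrib power2_eq_square)
      also have "\<dots> \<le> h * h * (?y \<bullet> (P *v ?y))" using m(2) by (intro mult_left_mono) auto
      finally show ?thesis .
    qed
    ultimately show ?thesis by (simp add: algebra_simps)
  qed
  interpret damped_family T "\<lambda>x. x \<bullet> (P *v x)" m m M
    by (rule damped_family.intro[OF lin m(1) m M step])
  obtain V :: "real^'n \<Rightarrow> real" and C where V: "\<And>x. 0 \<le> V x" "\<And>x. V x \<le> C * norm x"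
    "\<And>x y. V (x + y) \<le> V x + V y" "\<And>a x. 0 \<le> a \<Longrightarrow> V (a *\<^sub>R x) \<le> a * V x"
    "\<And>l x. l \<in> weights \<Longrightarrow>
       V (\<Sum>i\<in>UNIV. l $ i *\<^sub>R T i x) + norm ((\<Sum>i\<in>UNIV. l $ i *\<^sub>R T i x) - x) \<le> V x"
    using ex_length_decreasing_function_convex_hull by blast
  have dec: "V (x + h *\<^sub>R (comb A l *v x)) + h * norm (comb A l *v x) \<le> V x" if l: "l \<in> weights" for l x
  proof -
    have "(\<Sum>i\<in>UNIV. l $ i *\<^sub>R T i x) = (\<Sum>i\<in>UNIV. l $ i) *\<^sub>R x + h *\<^sub>R (comb A l *v x)"
      unfolding T_def comb_mult_vector scaleR_sum_right scaleR_sum_left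
      by (simp add: scaleR_add_right sum.distrib mult.commute)
    then show ?thesis using V(5)[OF l, of x] l h by (simp add: weights_def)
  qed
  show ?thesis
    unfolding ct_weakly_convergent_def
  proof (intro allI impI)
    fix w x0 x
    assume w: "w \<in> borel_measurable (lebesgue_on {0..}) \<and> (\<forall>t\<ge>0. w t \<in> weights)"
      and sol: "ct_solution A w x \<and> x 0 = x0"
    have ac: "\<forall>T\<ge>0. abs_cont_on 0 T x"
      and ae: "AE t in lebesgue_on {0..}. (x has_vector_derivative comb A (w t) *v x t) (at t within {0..})"
      using sol by (auto simp: ct_solution_def)
    have "AE t in lebesgue_on {0..}. \<exists>v. (x has_vector_derivative v) (at t within {0..})
        \<and> V (x t + h *\<^sub>R v) + h * norm v \<le> V (x t)"
      using ae AE_space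
    proof eventually_elim
      case (elim t)
      then have "w t \<in> weights" using w by (simp add: space_restrict_space)
      with elim(1) dec show ?case by blast
    qed
    from displacement_le_decrease[OF V(2-4) ac h this]
    have "norm (x t - x s) \<le> V (x s) - V (x t)" if "0 \<le> s" "s \<le> t" for s t
      using that by blast
    then show "\<exists>xbar. (x \<longlongrightarrow> xbar) at_top"
      using V(1) by (intro convergent_if_displacement_le_decrease[of 0 x "\<lambda>t. V (x t)"]) auto
  qed
qed

theorem theorem5:
  fixes A :: "'m::finite \<Rightarrow> real^'n^'n"
  shows "((\<exists>P \<eta>. pos_def P \<and> 0 < \<eta> \<and> \<eta> < 1 \<and>
            (\<forall>i. neg_semidef
                   (\<eta> *\<^sub>R (transpose (A i) ** P ** A i - P)
                    + (1 - \<eta>) *\<^sub>R ((transpose (A i) - mat 1) ** P ** (A i - mat 1)))))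
          \<longrightarrow> dt_weakly_convergent A)
       \<and> ((\<exists>P \<epsilon>. pos_def P \<and> 0 < \<epsilon> \<and>
            (\<forall>i. neg_semidef
                   (transpose (A i) ** P + P ** A i + \<epsilon> *\<^sub>R (transpose (A i) ** P ** A i))))
          \<longrightarrow> ct_weakly_convergent A)"
  by (intro conjI impI; elim exE conjE)
    (erule (2) dt_weakly_convergent_if, erule spec, erule (1) ct_weakly_convergent_if, erule spec)

end
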